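(* For any infinite cardinal $\kappa$, $\kappa$-compactness of generalized topological spaces is closed-hereditary (every subspace on a closed subset of a $\kappa$-compact GTS is $\kappa$-compact) and productive (the product of any indexed set of $\kappa$-compact GTS's is $\kappa$-compact), and it is also inherited by surjective images (if $f:(X,\mu)\to(Y,\nu)$ is a continuous surjection and $(X,\mu)$ is $\kappa$-compact, then $(Y,\nu)$ is $\kappa$-compact).
   Context: A generalized topology (GT) on a set $X$ (possibly empty) is a family $\mu\subset P(X)$ with $\emptyset\in\mu$ closed under arbitrary unions; $(X,\mu)$ is a generalized topological space (GTS); members of $\mu$ are open, their complements closed. A map $f:(X,\mu)\to(Y,\nu)$ is continuous if $f^{-1}(N)\in\mu$ for all $N\in\nu$. The subspace on $X_0\subset X$ has GT $\{M\cap X_0\mid M\in\mu\}$. Products are categorical: $\prod_{\alpha\in J}(X_\alpha,\mu_\alpha)$ is the set $\prod_\alpha X_\alpha$ with the GT $\{\bigcup_{\alpha\in J}\pi_\alpha^{-1}(M_\alpha)\mid M_\alpha\in\mu_\alpha\}$, where the $\pi_\alpha$ are the projections; the empty product is a one-point set with GT $\{\emptyset\}$. For an infinite cardinal $\kappa$, a GTS $(X,\mu)$ is $\kappa$-compact if every cover of $X$ by open sets has a subcover of $X$ of cardinality less than $\kappa$ (in particular, it is vacuously $\kappa$-compact if $X\notin\mu$). For $\kappa=\aleph_0$ this is compactness, for $\kappa=\aleph_1$ the Lindelöf property. *)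

theory Defs
  imports "HOL-Library.FuncSet" "HOL-Library.Countable_Set"
begin

unbundle cardinal_syntax

text \<open>The carrier is kept as a separate argument because it need not be open, so it cannot be
  recovered as the union of the open sets.\<close>

definition gts :: "'a set \<Rightarrow> 'a set set \<Rightarrow> bool" where
  "gts X \<mu> \<longleftrightarrow> \<mu> \<subseteq> Pow X \<and> {} \<in> \<mu> \<and> (\<forall>\<U>. \<U> \<subseteq> \<mu> \<longrightarrow> \<Union>\<U> \<in> \<mu>)"

definition gts_closed :: "'a set \<Rightarrow> 'a set set \<Rightarrow> 'a set \<Rightarrow> bool" where
  "gts_closed X \<mu> A \<longleftrightarrow> A \<subseteq> X \<and> X - A \<in> \<mu>"

definition gts_continuous ::
    "'a set \<Rightarrow> 'a set set \<Rightarrow> 'b set \<Rightarrow> 'b set set \<Rightarrow> ('a \<Rightarrow> 'b) \<Rightarrow> bool" where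
  "gts_continuous X \<mu> Y \<nu> f \<longleftrightarrow> f \<in> X \<rightarrow> Y \<and> (\<forall>N\<in>\<nu>. f -` N \<inter> X \<in> \<mu>)"

definition gts_subspace :: "'a set set \<Rightarrow> 'a set \<Rightarrow> 'a set set" where
  "gts_subspace \<mu> A = {M \<inter> A |M. M \<in> \<mu>}"

text \<open>The GT of the product, whose carrier is \<open>\<Pi>\<^sub>E \<alpha>\<in>J. X \<alpha>\<close>. For \<open>J = {}\<close> the carrier is a singleton
  and the GT is \<open>{{}}\<close>.\<close>

definition gts_product :: "'i set \<Rightarrow> ('i \<Rightarrow> 'a set) \<Rightarrow> ('i \<Rightarrow> 'a set set) \<Rightarrow> ('i \<Rightarrow> 'a) set set" where
  "gts_product J X \<mu> =
     {\<Union>\<alpha>\<in>J. {x \<in> (\<Pi>\<^sub>E \<beta>\<in>J. X \<beta>). x \<alpha> \<in> M \<alpha>} |M. \<forall>\<alpha>\<in>J. M \<alpha> \<in> \<mu> \<alpha>}"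

text \<open>An infinite cardinal \<open>\<kappa>\<close> is a well-order relation with \<open>Card_order \<kappa>\<close> and infinite field.\<close>

definition kappa_compact :: "'k rel \<Rightarrow> 'a set \<Rightarrow> 'a set set \<Rightarrow> bool" where
  "kappa_compact \<kappa> X \<mu> \<longleftrightarrow>
     (\<forall>\<U>. \<U> \<subseteq> \<mu> \<and> \<Union>\<U> = X \<longrightarrow> (\<exists>\<V>. \<V> \<subseteq> \<U> \<and> \<Union>\<V> = X \<and> |\<V>| <o \<kappa>))"

lemma gts_gts_subspace:
  assumes "gts X \<mu>"
  shows "gts A (gts_subspace \<mu> A)"
  unfolding gts_def
proof (intro conjI allI impI)
  show "gts_subspace \<mu> A \<subseteq> Pow A" by (auto simp: gts_subspace_def)
  have "{} \<in> \<mu>" using assms by (simp add: gts_def)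
  then show "{} \<in> gts_subspace \<mu> A" by (force simp: gts_subspace_def)
next
  fix \<U> assume U: "\<U> \<subseteq> gts_subspace \<mu> A"
  define \<M> where "\<M> = {M \<in> \<mu>. M \<inter> A \<in> \<U>}"
  have "\<Union>\<M> \<in> \<mu>" using assms by (auto simp: gts_def \<M>_def)
  moreover have "\<Union>\<U> = \<Union>\<M> \<inter> A"
    using U unfolding gts_subspace_def \<M>_def by blast
  ultimately show "\<Union>\<U> \<in> gts_subspace \<mu> A" by (auto simp: gts_subspace_def)
qed

lemma gts_gts_product:
  assumes "\<And>\<alpha>. \<alpha> \<in> J \<Longrightarrow> gts (X \<alpha>) (\<mu> \<alpha>)"
  shows "gts (\<Pi>\<^sub>E \<alpha>\<in>J. X \<alpha>) (gts_product J X \<mu>)"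
  unfolding gts_def
proof (intro conjI allI impI)
  show "gts_product J X \<mu> \<subseteq> Pow (\<Pi>\<^sub>E \<alpha>\<in>J. X \<alpha>)" by (auto simp: gts_product_def)
  have "\<forall>\<alpha>\<in>J. {} \<in> \<mu> \<alpha>" using assms by (simp add: gts_def)
  then show "{} \<in> gts_product J X \<mu>"
    unfolding gts_product_def by (intro CollectI exI[of _ "\<lambda>_. {}"]) auto
next
  fix \<U> assume U: "\<U> \<subseteq> gts_product J X \<mu>"
  define cyl where "cyl M = (\<Union>\<alpha>\<in>J. {x \<in> (\<Pi>\<^sub>E \<beta>\<in>J. X \<beta>). x \<alpha> \<in> M \<alpha>})" for M
  have "\<forall>S\<in>\<U>. \<exists>M. S = cyl M \<and> (\<forall>\<alpha>\<in>J. M \<alpha> \<in> \<mu> \<alpha>)"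
    using U by (auto simp: gts_product_def cyl_def)
  then obtain F where F: "\<And>S. S \<in> \<U> \<Longrightarrow> S = cyl (F S) \<and> (\<forall>\<alpha>\<in>J. F S \<alpha> \<in> \<mu> \<alpha>)" by metis
  have "\<Union>\<U> = (\<Union>S\<in>\<U>. cyl (F S))" using F by auto
  also have "\<dots> = cyl (\<lambda>\<alpha>. \<Union>S\<in>\<U>. F S \<alpha>)" by (auto simp: cyl_def)
  finally have "\<Union>\<U> = cyl (\<lambda>\<alpha>. \<Union>S\<in>\<U>. F S \<alpha>)" .
  moreover have "\<forall>\<alpha>\<in>J. (\<Union>S\<in>\<U>. F S \<alpha>) \<in> \<mu> \<alpha>"
  proof
    fix \<alpha> assume a: "\<alpha> \<in> J"
    have "(\<lambda>S. F S \<alpha>) ` \<U> \<subseteq> \<mu> \<alpha>" using F a by auto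
    then show "(\<Union>S\<in>\<U>. F S \<alpha>) \<in> \<mu> \<alpha>" using assms[OF a] unfolding gts_def by blast
  qed
  ultimately show "\<Union>\<U> \<in> gts_product J X \<mu>"
    unfolding gts_product_def cyl_def
    by (intro CollectI exI[of _ "\<lambda>\<alpha>. \<Union>S\<in>\<U>. F S \<alpha>"] conjI)
qed

lemma gts_continuous_projection:
  assumes "\<And>\<alpha>. \<alpha> \<in> J \<Longrightarrow> gts (X \<alpha>) (\<mu> \<alpha>)" and \<alpha>: "\<alpha> \<in> J"
  shows "gts_continuous (\<Pi>\<^sub>E \<alpha>\<in>J. X \<alpha>) (gts_product J X \<mu>) (X \<alpha>) (\<mu> \<alpha>) (\<lambda>x. x \<alpha>)"
  unfolding gts_continuous_def
proof (intro conjI ballI)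
  show "(\<lambda>x. x \<alpha>) \<in> (\<Pi>\<^sub>E \<alpha>\<in>J. X \<alpha>) \<rightarrow> X \<alpha>" using \<alpha> by auto
  fix N assume N: "N \<in> \<mu> \<alpha>"
  define M where "M \<beta> = (if \<beta> = \<alpha> then N else {})" for \<beta>
  have "\<forall>\<beta>\<in>J. M \<beta> \<in> \<mu> \<beta>" using N assms(1) by (auto simp: M_def gts_def)
  moreover have "(\<lambda>x. x \<alpha>) -` N \<inter> (\<Pi>\<^sub>E \<alpha>\<in>J. X \<alpha>) =
      (\<Union>\<beta>\<in>J. {x \<in> (\<Pi>\<^sub>E \<beta>\<in>J. X \<beta>). x \<beta> \<in> M \<beta>})"
    using \<alpha> by (auto simp: M_def split: if_splits)
  ultimately show "(\<lambda>x. x \<alpha>) -` N \<inter> (\<Pi>\<^sub>E \<alpha>\<in>J. X \<alpha>) \<in> gts_product J X \<mu>"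
    unfolding gts_product_def by (intro CollectI exI[of _ M] conjI)
qed

lemma gts_continuous_into_product:
  assumes "gts Z \<zeta>" and "f \<in> Z \<rightarrow> (\<Pi>\<^sub>E \<alpha>\<in>J. X \<alpha>)"
    and c: "\<And>\<alpha>. \<alpha> \<in> J \<Longrightarrow> gts_continuous Z \<zeta> (X \<alpha>) (\<mu> \<alpha>) (\<lambda>z. f z \<alpha>)"
  shows "gts_continuous Z \<zeta> (\<Pi>\<^sub>E \<alpha>\<in>J. X \<alpha>) (gts_product J X \<mu>) f"
  unfolding gts_continuous_def
proof (intro conjI ballI)
  show "f \<in> Z \<rightarrow> (\<Pi>\<^sub>E \<alpha>\<in>J. X \<alpha>)" by fact
  fix N assume "N \<in> gts_product J X \<mu>"
  then obtain M where M: "\<forall>\<alpha>\<in>J. M \<alpha> \<in> \<mu> \<alpha>"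
    and N: "N = (\<Union>\<alpha>\<in>J. {x \<in> (\<Pi>\<^sub>E \<beta>\<in>J. X \<beta>). x \<alpha> \<in> M \<alpha>})"
    by (auto simp: gts_product_def)
  have "f -` N \<inter> Z = (\<Union>\<alpha>\<in>J. (\<lambda>z. f z \<alpha>) -` M \<alpha> \<inter> Z)"
    using assms(2) unfolding N by blast
  moreover have "(\<lambda>\<alpha>. (\<lambda>z. f z \<alpha>) -` M \<alpha> \<inter> Z) ` J \<subseteq> \<zeta>"
    using c M by (auto simp: gts_continuous_def)
  ultimately show "f -` N \<inter> Z \<in> \<zeta>"
    using assms(1) unfolding gts_def by metis
qed

lemma kappa_compact_vacuous:
  assumes "gts X \<mu>" and "X \<notin> \<mu>"
  shows "kappa_compact \<kappa> X \<mu>"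
  using assms unfolding gts_def kappa_compact_def by blast

lemma kappa_compact_aleph0:
  "kappa_compact natLeq X \<mu> \<longleftrightarrow>
     (\<forall>\<U>. \<U> \<subseteq> \<mu> \<and> \<Union>\<U> = X \<longrightarrow> (\<exists>\<V>. \<V> \<subseteq> \<U> \<and> \<Union>\<V> = X \<and> finite \<V>))"
  by (simp add: kappa_compact_def finite_iff_ordLess_natLeq)

lemma kappa_compact_aleph1:
  "kappa_compact (cardSuc natLeq) X \<mu> \<longleftrightarrow>
     (\<forall>\<U>. \<U> \<subseteq> \<mu> \<and> \<Union>\<U> = X \<longrightarrow> (\<exists>\<V>. \<V> \<subseteq> \<U> \<and> \<Union>\<V> = X \<and> countable \<V>))"
proof -
  have "|A| <o cardSuc natLeq \<longleftrightarrow> countable A" for A :: "'a set set"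
  proof -
    have "|A| <o cardSuc natLeq \<longleftrightarrow> |A| \<le>o natLeq"
      by (rule cardSuc_ordLeq_ordLess[OF natLeq_Card_order card_of_Card_order])
    also have "\<dots> \<longleftrightarrow> |A| \<le>o |UNIV :: nat set|"
      using card_of_nat ordIso_symmetric ordLeq_ordIso_trans by blast
    also have "\<dots> \<longleftrightarrow> countable A"
      by (simp add: card_of_ordLeq[symmetric] countable_def)
    finally show ?thesis .
  qed
  then show ?thesis by (simp add: kappa_compact_def)
qed

end

theory Submission
  imports Defs
begin

text \<open>
  Each of the three claims transports an open cover to a space known to be
  \<open>\<kappa>\<close>-compact, thins it there, and transports the small subcover back. For a closed subset one adds
  the open complement to the extensions of the covering sets; for a continuous surjection one takes
  preimages.

  Products need no analogue of Tychonoff's theorem, because here an open set is merely a union of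
  subbasic cylinders: finite intersections are not formed. Gather the cylinder bases that a
  cover of the product uses over one coordinate \<open>\<alpha>\<close>. If for every \<open>\<alpha>\<close> they left a point \<open>x\<^sub>\<alpha>\<close> of
  \<open>X\<^sub>\<alpha>\<close> uncovered, the point \<open>(x\<^sub>\<alpha>)\<close> of the product would lie in no member of the cover. So over some
  single coordinate the bases already cover \<open>X\<^sub>\<alpha>\<close>, and a small subcover of that one factor
  gives a small subcover of the product.
\<close>

lemma kappa_compact_subcover:
  assumes "kappa_compact \<kappa> X \<mu>" and "\<U> \<subseteq> \<mu>" and "\<Union>\<U> = X"
  obtains \<V> where "\<V> \<subseteq> \<U>" and "\<Union>\<V> = X" and "|\<V>| <o \<kappa>"
  using assms(1)[unfolded kappa_compact_def, rule_format, OF conjI, OF assms(2,3)] that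
  by (elim exE conjE)

lemma kappa_compactI:
  assumes "\<And>\<U>. \<U> \<subseteq> \<mu> \<Longrightarrow> \<Union>\<U> = X \<Longrightarrow> \<exists>\<V>\<subseteq>\<U>. X \<subseteq> \<Union>\<V> \<and> |\<V>| <o \<kappa>"
  shows "kappa_compact \<kappa> X \<mu>"
  unfolding kappa_compact_def
proof (intro allI impI, elim conjE)
  fix \<U> assume \<U>: "\<U> \<subseteq> \<mu>" "\<Union>\<U> = X"
  obtain \<V> where \<V>: "\<V> \<subseteq> \<U>" "X \<subseteq> \<Union>\<V>" "|\<V>| <o \<kappa>"
    using assms[OF \<U>] by (elim exE conjE)
  have "\<Union>\<V> \<subseteq> X"
    using Union_mono[OF \<V>(1)] \<U>(2) by simp
  with \<V> show "\<exists>\<V>. \<V> \<subseteq> \<U> \<and> \<Union>\<V> = X \<and> |\<V>| <o \<kappa>"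
    by (intro exI[of _ \<V>] conjI equalityI)
qed

text \<open>Covers indexed by an arbitrary set let subcovers be pulled back along the index, even when
  distinct indices give the same open set: one index is chosen for each set that is kept.\<close>

lemma kappa_compact_indexed_subcover:
  assumes "kappa_compact \<kappa> X \<mu>" and "G ` I \<subseteq> \<mu>" and "\<Union>(G ` I) = X"
  obtains I' where "I' \<subseteq> I" and "\<Union>(G ` I') = X" and "|I'| <o \<kappa>"
proof -
  obtain \<V> where \<V>: "\<V> \<subseteq> G ` I" "\<Union>\<V> = X" "|\<V>| <o \<kappa>"
    using assms by (rule kappa_compact_subcover)
  let ?I' = "inv_into I G ` \<V>"
  have "?I' \<subseteq> I"
    using \<V>(1) by (auto intro: inv_into_into)
  moreover have "G ` ?I' = \<V>"
    using \<V>(1) by (rule image_inv_into_cancel[OF refl])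
  moreover have "|?I'| <o \<kappa>"
    using card_of_image \<V>(3) by (rule ordLeq_ordLess_trans)
  ultimately show thesis
    using that \<V>(2) by metis
qed

lemma kappa_compact_closed_subspace:
  assumes "gts X \<mu>" and "kappa_compact \<kappa> X \<mu>" and "gts_closed X \<mu> A"
  shows "kappa_compact \<kappa> A (gts_subspace \<mu> A)"
proof (rule kappa_compactI)
  fix \<U> assume \<U>: "\<U> \<subseteq> gts_subspace \<mu> A" "\<Union>\<U> = A"
  have A: "A \<subseteq> X" "X - A \<in> \<mu>"
    using assms(3) by (simp_all add: gts_closed_def)
  have \<mu>: "\<And>M. M \<in> \<mu> \<Longrightarrow> M \<subseteq> X"
    using assms(1) by (auto simp: gts_def)
  let ?\<W> = "insert (X - A) {M \<in> \<mu>. M \<inter> A \<in> \<U>}"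
  have "A \<subseteq> \<Union>{M \<in> \<mu>. M \<inter> A \<in> \<U>}"
    using \<U> unfolding gts_subspace_def by blast
  moreover have "\<Union>{M \<in> \<mu>. M \<inter> A \<in> \<U>} \<subseteq> X"
    using \<mu> by (simp add: Sup_le_iff)
  ultimately have cover: "\<Union>?\<W> = X"
    using A(1) by auto
  have "?\<W> \<subseteq> \<mu>"
    using A(2) by blast
  with assms(2) obtain \<V> where \<V>: "\<V> \<subseteq> ?\<W>" "\<Union>\<V> = X" "|\<V>| <o \<kappa>"
    using cover by (rule kappa_compact_subcover)
  \<comment> \<open>The complement must be dropped before tracing on \<open>A\<close>: its trace is empty, and the
      given cover need not contain the empty set.\<close>
  let ?\<V>' = "(\<lambda>M. M \<inter> A) ` (\<V> - {X - A})"
  have "?\<V>' \<subseteq> \<U>"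
    using \<V>(1) by blast
  moreover have "A \<subseteq> \<Union>?\<V>'"
  proof
    fix x assume "x \<in> A"
    moreover from this obtain M where "M \<in> \<V>" "x \<in> M"
      using \<V>(2) A(1) by blast
    ultimately show "x \<in> \<Union>?\<V>'"
      by blast
  qed
  moreover have "|?\<V>'| <o \<kappa>"
    using card_of_image ordLeq_ordLess_trans[OF card_of_mono1[OF Diff_subset] \<V>(3)]
    by (rule ordLeq_ordLess_trans)
  ultimately show "\<exists>\<V>\<subseteq>\<U>. A \<subseteq> \<Union>\<V> \<and> |\<V>| <o \<kappa>"
    by (intro exI[of _ ?\<V>'] conjI)
qed

text \<open>The reason why one factor suffices. The hypothesis forces \<open>J\<close> to be nonempty, since the
  empty product has a point but no cylinders; and if some factor is empty, that factor is a
  legitimate choice of coordinate.\<close>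

lemma cylinder_cover_covers_factor:
  assumes "(\<Pi>\<^sub>E \<beta>\<in>J. X \<beta>) \<subseteq> (\<Union>S\<in>\<U>. \<Union>\<alpha>\<in>J. {x \<in> (\<Pi>\<^sub>E \<beta>\<in>J. X \<beta>). x \<alpha> \<in> F S \<alpha>})"
  shows "\<exists>\<alpha>\<in>J. X \<alpha> \<subseteq> (\<Union>S\<in>\<U>. F S \<alpha>)"
proof (rule ccontr)
  assume "\<not> ?thesis"
  then have "\<forall>\<alpha>\<in>J. \<exists>y. y \<in> X \<alpha> - (\<Union>S\<in>\<U>. F S \<alpha>)"
    by blast
  then obtain x where x: "\<And>\<alpha>. \<alpha> \<in> J \<Longrightarrow> x \<alpha> \<in> X \<alpha> - (\<Union>S\<in>\<U>. F S \<alpha>)"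
    by metis
  then have "restrict x J \<in> (\<Pi>\<^sub>E \<beta>\<in>J. X \<beta>)"
    by (simp add: PiE_def Pi_def)
  then have "\<exists>S\<in>\<U>. \<exists>\<alpha>\<in>J. restrict x J \<alpha> \<in> F S \<alpha>"
    using assms by blast
  then show False
    using x by fastforce
qed

lemma kappa_compact_product:
  assumes gts: "\<And>\<alpha>. \<alpha> \<in> J \<Longrightarrow> gts (X \<alpha>) (\<mu> \<alpha>)"
    and compact: "\<And>\<alpha>. \<alpha> \<in> J \<Longrightarrow> kappa_compact \<kappa> (X \<alpha>) (\<mu> \<alpha>)"
  shows "kappa_compact \<kappa> (\<Pi>\<^sub>E \<alpha>\<in>J. X \<alpha>) (gts_product J X \<mu>)"
proof (rule kappa_compactI)
  fix \<U> assume \<U>: "\<U> \<subseteq> gts_product J X \<mu>" "\<Union>\<U> = (\<Pi>\<^sub>E \<alpha>\<in>J. X \<alpha>)"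
  define cyl where "cyl M = (\<Union>\<alpha>\<in>J. {x \<in> (\<Pi>\<^sub>E \<beta>\<in>J. X \<beta>). x \<alpha> \<in> M \<alpha>})" for M
  have "\<forall>S\<in>\<U>. \<exists>M. S = cyl M \<and> (\<forall>\<alpha>\<in>J. M \<alpha> \<in> \<mu> \<alpha>)"
    using \<U>(1) by (auto simp: gts_product_def cyl_def)
  then obtain F where F: "\<And>S. S \<in> \<U> \<Longrightarrow> S = cyl (F S) \<and> (\<forall>\<alpha>\<in>J. F S \<alpha> \<in> \<mu> \<alpha>)"
    by metis
  have "(\<Pi>\<^sub>E \<alpha>\<in>J. X \<alpha>) \<subseteq> (\<Union>S\<in>\<U>. cyl (F S))"
    using \<U>(2) F by auto
  then obtain \<alpha> where \<alpha>: "\<alpha> \<in> J" "X \<alpha> \<subseteq> (\<Union>S\<in>\<U>. F S \<alpha>)"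
    using cylinder_cover_covers_factor[of J X F \<U>] unfolding cyl_def by blast
  have "F S \<alpha> \<in> \<mu> \<alpha>" if "S \<in> \<U>" for S
    using F[OF that] \<alpha>(1) by simp
  then have bases: "(\<lambda>S. F S \<alpha>) ` \<U> \<subseteq> \<mu> \<alpha>"
    by (rule image_subsetI)
  have "\<mu> \<alpha> \<subseteq> Pow (X \<alpha>)"
    using gts[OF \<alpha>(1)] by (simp add: gts_def)
  then have "(\<Union>S\<in>\<U>. F S \<alpha>) = X \<alpha>"
    using bases \<alpha>(2) by blast
  with compact[OF \<alpha>(1)] bases
  obtain \<V> where \<V>: "\<V> \<subseteq> \<U>" "(\<Union>S\<in>\<V>. F S \<alpha>) = X \<alpha>" "|\<V>| <o \<kappa>"
    by (rule kappa_compact_indexed_subcover)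
  have "(\<Pi>\<^sub>E \<alpha>\<in>J. X \<alpha>) \<subseteq> \<Union>\<V>"
  proof
    fix x assume x: "x \<in> (\<Pi>\<^sub>E \<alpha>\<in>J. X \<alpha>)"
    then have "x \<alpha> \<in> X \<alpha>"
      using \<alpha>(1) by auto
    then obtain S where S: "S \<in> \<V>" "x \<alpha> \<in> F S \<alpha>"
      using \<V>(2) by blast
    then have "x \<in> cyl (F S)"
      using x \<alpha>(1) by (auto simp: cyl_def)
    then show "x \<in> \<Union>\<V>"
      using S(1) F \<V>(1) by blast
  qed
  with \<V>(1,3) show "\<exists>\<V>\<subseteq>\<U>. (\<Pi>\<^sub>E \<alpha>\<in>J. X \<alpha>) \<subseteq> \<Union>\<V> \<and> |\<V>| <o \<kappa>"
    by (intro exI[of _ \<V>] conjI)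
qed

lemma kappa_compact_continuous_image:
  assumes "kappa_compact \<kappa> X \<mu>" and "gts_continuous X \<mu> Y \<nu> f" and "f ` X = Y"
  shows "kappa_compact \<kappa> Y \<nu>"
proof (rule kappa_compactI)
  fix \<U> assume \<U>: "\<U> \<subseteq> \<nu>" "\<Union>\<U> = Y"
  have preimages: "(\<lambda>N. f -` N \<inter> X) ` \<U> \<subseteq> \<mu>"
    using \<U>(1) assms(2) by (auto simp: gts_continuous_def)
  have "(\<Union>N\<in>\<U>. f -` N \<inter> X) = X"
    using \<U>(2) assms(3) by blast
  with assms(1) preimages
  obtain \<V> where \<V>: "\<V> \<subseteq> \<U>" "(\<Union>N\<in>\<V>. f -` N \<inter> X) = X" "|\<V>| <o \<kappa>"
    by (rule kappa_compact_indexed_subcover)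
  have "Y \<subseteq> \<Union>\<V>"
    using \<V>(2) assms(3) by blast
  with \<V>(1,3) show "\<exists>\<V>\<subseteq>\<U>. Y \<subseteq> \<Union>\<V> \<and> |\<V>| <o \<kappa>"
    by (intro exI[of _ \<V>] conjI)
qed

theorem proposition4p18:
  fixes \<kappa> :: "'k rel"
  assumes "Card_order \<kappa>" and "infinite (Field \<kappa>)"
  shows
    "(\<forall>(X :: 'a set) \<mu> A.
        gts X \<mu> \<and> kappa_compact \<kappa> X \<mu> \<and> gts_closed X \<mu> A \<longrightarrow>
        kappa_compact \<kappa> A (gts_subspace \<mu> A)) \<and>
     (\<forall>(J :: 'i set) (X :: 'i \<Rightarrow> 'b set) \<mu>.
        (\<forall>\<alpha>\<in>J. gts (X \<alpha>) (\<mu> \<alpha>) \<and> kappa_compact \<kappa> (X \<alpha>) (\<mu> \<alpha>)) \<longrightarrow>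
        kappa_compact \<kappa> (\<Pi>\<^sub>E \<alpha>\<in>J. X \<alpha>) (gts_product J X \<mu>)) \<and>
     (\<forall>(X :: 'c set) \<mu> (Y :: 'd set) \<nu> f.
        gts X \<mu> \<and> gts Y \<nu> \<and> gts_continuous X \<mu> Y \<nu> f \<and> f ` X = Y \<and> kappa_compact \<kappa> X \<mu> \<longrightarrow>
        kappa_compact \<kappa> Y \<nu>)"
proof (intro conjI allI impI)
  show "kappa_compact \<kappa> A (gts_subspace \<mu> A)"
    if "gts X \<mu> \<and> kappa_compact \<kappa> X \<mu> \<and> gts_closed X \<mu> A" for X :: "'a set" and \<mu> A
    using that kappa_compact_closed_subspace by metis
  show "kappa_compact \<kappa> (\<Pi>\<^sub>E \<alpha>\<in>J. X \<alpha>) (gts_product J X \<mu>)"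
    if "\<forall>\<alpha>\<in>J. gts (X \<alpha>) (\<mu> \<alpha>) \<and> kappa_compact \<kappa> (X \<alpha>) (\<mu> \<alpha>)"
    for J :: "'i set" and X :: "'i \<Rightarrow> 'b set" and \<mu>
    using that by (simp add: kappa_compact_product)
  show "kappa_compact \<kappa> Y \<nu>"
    if "gts X \<mu> \<and> gts Y \<nu> \<and> gts_continuous X \<mu> Y \<nu> f \<and> f ` X = Y \<and> kappa_compact \<kappa> X \<mu>"
    for X :: "'c set" and \<mu> and Y :: "'d set" and \<nu> f
    using that kappa_compact_continuous_image by metis
qed

end
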